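(* Let $\ell$ and $n$ be nonnegative integers and let $a,q$ be nonzero complex numbers such that no zero factor appears in any denominator occurring in the identity below. Then $$\sum_{k=0}^{n}(a;q^3)_k\,\frac{(q^{-n};q)_k\,(q^{n-\ell}a;q)_k}{(q;q)_k(\sqrt a;q)_k(-\sqrt a;q)_k(\sqrt{qa};q)_k(-\sqrt{qa};q)_k}\,q^k$$ $$=\frac{(q^{n-\ell}a;q)_\ell}{(q^{2n-\ell}a;q)_\ell}\sum_{i=0}^{\ell}a^{\frac{n+2i}{3}}\,q^{(\ell+2n-i)i}\,\frac{a-q^{2i-2n}}{a-q^{-2n}}\,\frac{(q^{-\ell};q)_i(q^{-n};q)_i(q^{-2n}/a;q)_i}{(q;q)_i(q^{1+\ell-2n}/a;q)_i(q^{n-i}a;q)_i}\cdot\frac{(q;q^3)_{\frac{n-i}{3}}(q^2;q^3)_{\frac{n-i}{3}}}{(qa;q^3)_{\frac{n-i}{3}}(q^2a;q^3)_{\frac{n-i}{3}}}\,\chi(n-i).$$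
   Context: For complex $x,q$ and an integer $m$, the $q$-shifted factorial is $(x;q)_m=\prod_{j=0}^{m-1}(1-xq^j)$ for $m>0$, $(x;q)_0=1$, and $(x;q)_m=1/\prod_{j=m}^{-1}(1-xq^j)$ for $m<0$; $(x;q^3)_m$ is the same with $q$ replaced by $q^3$. For an integer $N$, $\chi(N)=1$ if $3\mid N$ and $\chi(N)=0$ otherwise; a summand containing $\chi(n-i)=0$ is understood to be $0$, so only indices $i$ with $(n-i)/3\in\mathbb Z$ contribute (and then $(n+2i)/3\in\mathbb Z$). $\sqrt a$ and $\sqrt{qa}$ denote any fixed square roots of $a$ and $qa$. *)

theory Defs
  imports Complex_Main
begin

definition qpoch :: "complex \<Rightarrow> complex \<Rightarrow> int \<Rightarrow> complex" where
  "qpoch x q m =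
     (if m \<ge> 0 then (\<Prod>j\<in>{0..<m}. 1 - x * q powi j)
      else 1 / (\<Prod>j\<in>{m..<0}. 1 - x * q powi j))"

text \<open>
  For \<open>m < 0\<close> the symbol \<open>qpoch x q m\<close> is itself a reciprocal. The following predicate says that
  none of the factors of its denominator vanishes; it is vacuous for \<open>m \<ge> 0\<close>.
\<close>
definition qpoch_defined :: "complex \<Rightarrow> complex \<Rightarrow> int \<Rightarrow> bool" where
  "qpoch_defined x q m \<longleftrightarrow> (\<forall>j\<in>{m..<0}. 1 - x * q powi j \<noteq> 0)"

definition chi :: "int \<Rightarrow> complex" where
  "chi N = (if 3 dvd N then 1 else 0)"

end

theory Submission
  imports Defs "HOL-Analysis.Uncountable_Sets"
begin

text \<open>
  The denominator on the left is \<open>(q;q)\<^sub>k (a;q)\<^sub>2\<^sub>k\<close>. For \<open>\<ell> = 0\<close> the sum \<open>S(n)\<close> obeys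
  \<open>S(n) = r(n) S(n - 3)\<close>, because the corresponding combination of summands telescopes; moreover
  \<open>r(1) = r(2) = 0\<close>, which produces the factor \<open>\<chi>\<close>. For general \<open>\<ell>\<close>, with \<open>u = q\<^sup>n\<close>, the product
  \<open>(1/u;q)\<^sub>k (u a/q\<^sup>\<ell>;q)\<^sub>k\<close> is a combination of the products \<open>(q\<^sup>i/u;q)\<^sub>k (u a/q\<^sup>i;q)\<^sub>k\<close> with
  \<open>0 \<le> i \<le> \<ell>\<close> whose coefficients do not depend on \<open>k\<close>, so the sum reduces to the values \<open>S(n - i)\<close>.
  Intermediate steps divide by quantities that the hypotheses do not control; hence the identity is
  proved for \<open>q\<close> not a root of unity and \<open>a\<close> not a power of \<open>q\<close>, and then extended by continuity
  of both sides.
\<close>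

section \<open>Finite q-shifted factorials with a natural number of factors\<close>

text \<open>A version of \<open>qpoch\<close> indexed by naturals, so that factors can be split off
  at either end by induction; \<open>qpoch_of_nat\<close> links the two.\<close>

definition qprod :: "complex \<Rightarrow> complex \<Rightarrow> nat \<Rightarrow> complex" where
  "qprod x q k = (\<Prod>j<k. 1 - x * q ^ j)"

lemma qprod_0 [simp]: "qprod x q 0 = 1"
  by (simp add: qprod_def)

lemma qprod_Suc: "qprod x q (Suc k) = qprod x q k * (1 - x * q ^ k)"
  by (simp add: qprod_def)

lemma qprod_Suc_left: "qprod x q (Suc k) = (1 - x) * qprod (x * q) q k"
  by (simp add: qprod_def prod.lessThan_Suc_shift mult.assoc del: prod.lessThan_Suc)

lemma qpoch_of_nat: "qpoch x q (int k) = qprod x q k"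
proof -
  have "qpoch x q (int k) = (\<Prod>j\<in>int ` {..<k}. 1 - x * q powi j)"
    by (simp add: qpoch_def image_int_atLeastLessThan flip: atLeast0LessThan)
  also have "\<dots> = qprod x q k"
    by (subst prod.reindex) (auto simp: qprod_def)
  finally show ?thesis .
qed

lemma qprod_eq_0_iff: "qprod x q k = 0 \<longleftrightarrow> (\<exists>j<k. x * q ^ j = 1)"
  by (auto simp: qprod_def)

text \<open>Factorwise this is the difference of two squares. It removes the square roots of
  \<open>a\<close> and \<open>q * a\<close> from the denominators.\<close>

lemma qprod_pair_square:
  assumes "s ^ 2 = x"
  shows "qprod s q k * qprod (- s) q k = qprod x (q ^ 2) k"
  unfolding qprod_def prod.distrib [symmetric]
  by (rule prod.cong)
     (auto simp: assms[symmetric] algebra_simps power2_eq_square power_mult_distrib)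

text \<open>The factors with even and with odd powers of \<open>q\<close> interleave. This merges
  the four square-root products into one product of length \<open>2 * k\<close>.\<close>

lemma qprod_even_odd: "qprod x (q ^ 2) k * qprod (q * x) (q ^ 2) k = qprod x q (2 * k)"
  by (induction k) (simp_all add: qprod_Suc power_mult [symmetric] mult_ac)

section \<open>The sum for the parameter value zero: a recurrence with step three\<close>

text \<open>
  For \<open>b = q\<^bsup>1-n\<^esup>\<close> and \<open>c = q\<^bsup>n-3\<^esup> a\<close> the two products in the summand belong to \<open>S(n)\<close> and \<open>S(n - 3)\<close>.
  Writing the second one with \<open>qprod b q (k + 2)\<close> absorbs the numerator of \<open>r(n)\<close>, so that \<open>n = 1, 2\<close> are covered.
\<close>
lemma cubic_telescope:
  assumes "a = b * c * q ^ 2" and "b \<noteq> 0" and "q \<noteq> 0"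
    and q: "\<And>k. q ^ Suc k \<noteq> 1" and a: "\<And>k. a * q ^ k \<noteq> 1"
    and c: "c \<noteq> 1" "c * q \<noteq> 1" "c * q ^ 2 \<noteq> 1"
  shows "(\<Sum>k\<le>m. qprod a (q ^ 3) k * q ^ k / (qprod q q k * qprod a q (2 * k))
            * (qprod (b / q) q k * qprod (c * q ^ 3) q k
               - c * q / b * qprod b q (k + 2) * qprod c q k / ((1 - c * q) * (1 - c * q ^ 2))))
         = (1 - c * q / b) * qprod a (q ^ 3) (Suc m) / (qprod q q m * qprod a q (2 * m))
            * qprod b q m * qprod c q (Suc m) / ((1 - c) * (1 - c * q) * (1 - c * q ^ 2))"
proof (induction m)
  case 0
  show ?case using c \<open>b \<noteq> 0\<close> \<open>q \<noteq> 0\<close>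
    by (simp add: qprod_Suc assms(1) numeral_2_eq_2 divide_simps) algebra
next
  case (Suc m)
  \<comment> \<open>In terms of \<open>y = q ^ m\<close> every product is a block shared by all
    terms times finitely many explicit factors, so the induction step becomes the polynomial
    identity \<open>key\<close>.\<close>
  define y where "y = q ^ m"
  define A Q E X Z where "A = qprod a (q ^ 3) (Suc m)" and "Q = qprod q q m"
    and "E = qprod a q (2 * m)" and "X = qprod b q m" and "Z = qprod c q m"
  have Q: "Q \<noteq> 0" using q by (auto simp: Q_def qprod_eq_0_iff simp flip: power_Suc)
  have E: "E \<noteq> 0" using a by (auto simp: E_def qprod_eq_0_iff)
  have d: "1 - q * y \<noteq> 0" "1 - a * y ^ 2 \<noteq> 0" "1 - a * q * y ^ 2 \<noteq> 0"
    using q[of m] a[of "2 * m"] a[of "2 * m + 1"]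
    by (auto simp: y_def power_mult [symmetric] mult_ac)
  define D where "D = (1 - c) * (1 - c * q) * (1 - c * q ^ 2)"
  have D: "D \<noteq> 0" using c by (simp add: D_def)
  have e1: "qprod q q (Suc m) = Q * (1 - q * y)"
    by (simp add: Q_def y_def qprod_Suc)
  have e2: "qprod a q (2 * Suc m) = E * (1 - a * y ^ 2) * (1 - a * q * y ^ 2)"
    by (simp add: E_def y_def qprod_Suc power_mult [symmetric] mult_ac)
  have e3: "qprod (b / q) q (Suc m) = (1 - b / q) * X"
    using \<open>q \<noteq> 0\<close> by (simp add: qprod_Suc_left X_def)
  have e4: "qprod b q (Suc m + 2) = X * (1 - b * y) * (1 - b * q * y) * (1 - b * q ^ 2 * y)"
    by (simp add: X_def y_def qprod_Suc power2_eq_square mult_ac)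
  have e4': "qprod b q (Suc m) = X * (1 - b * y)"
    by (simp add: X_def y_def qprod_Suc)
  \<comment> \<open>\<open>D\<close> supplies the three missing initial factors, so that the product
    starting at \<open>c * q ^ 3\<close> can be compared with \<open>Z\<close>, which starts at
    \<open>c\<close>.\<close>
  have "D * qprod (c * q ^ 3) q (Suc m) = qprod c q (Suc m + 3)"
    by (simp add: D_def numeral_3_eq_3 qprod_Suc_left power2_eq_square mult_ac)
  also have "\<dots> = Z * (1 - c * y) * (1 - c * q * y) * (1 - c * q ^ 2 * y) * (1 - c * q ^ 3 * y)"
    by (simp add: Z_def y_def numeral_3_eq_3 qprod_Suc power2_eq_square mult_ac)
  finally have e5: "qprod (c * q ^ 3) q (Suc m) =
      Z * (1 - c * y) * (1 - c * q * y) * (1 - c * q ^ 2 * y) * (1 - c * q ^ 3 * y) / D"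
    using D by (simp add: field_simps)
  have e6: "qprod c q (Suc m) = Z * (1 - c * y)"
    "qprod c q (Suc (Suc m)) = Z * (1 - c * y) * (1 - c * q * y)"
    by (simp_all add: Z_def y_def qprod_Suc mult_ac)
  have e7: "qprod a (q ^ 3) (Suc (Suc m)) = A * (1 - a * q ^ 3 * y ^ 3)"
    by (simp add: A_def y_def qprod_Suc[of _ _ "Suc m"] power_mult [symmetric] power_add [symmetric] mult_ac)
  define R where "R = (1 - q * y) * (1 - a * y ^ 2) * (1 - a * q * y ^ 2)"
  have R: "R \<noteq> 0" using d by (simp add: R_def)
  have key: "(b - c * q) * R + y * ((q - b) * b * (1 - c * q * y) * (1 - c * q ^ 2 * y) * (1 - c * q ^ 3 * y)
      - c * q ^ 2 * (1 - b * y) * (1 - b * q * y) * (1 - b * q ^ 2 * y) * (1 - c))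
     = (b - c * q) * (1 - a * q ^ 3 * y ^ 3) * (1 - b * y) * (1 - c * q * y)"
    unfolding R_def assms(1) by algebra
  \<comment> \<open>The common factor of the old partial sum (\<open>t2\<close>), the new summand
    (\<open>t1\<close>) and the new closed form (\<open>t3\<close>); what remains of the three is
    exactly \<open>key\<close>.\<close>
  let ?C = "A * X * Z * (1 - c * y) / (Q * E * D * b * R)"
  let ?T = "A * (q * y) / (Q * (1 - q * y) * (E * (1 - a * y ^ 2) * (1 - a * q * y ^ 2)))
            * ((1 - b / q) * X * (Z * (1 - c * y) * (1 - c * q * y) * (1 - c * q ^ 2 * y) * (1 - c * q ^ 3 * y) / D)
               - c * q / b * (X * (1 - b * y) * (1 - b * q * y) * (1 - b * q ^ 2 * y)) * (Z * (1 - c * y)) / ((1 - c * q) * (1 - c * q ^ 2)))"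
  have cc: "1 / ((1 - c * q) * (1 - c * q ^ 2)) = (1 - c) / D"
    using c by (simp add: D_def)
  have t1: "?T = ?C * (y * ((q - b) * b * (1 - c * q * y) * (1 - c * q ^ 2 * y) * (1 - c * q ^ 3 * y)
      - c * q ^ 2 * (1 - b * y) * (1 - b * q * y) * (1 - b * q ^ 2 * y) * (1 - c)))"
  proof -
    have "?T = A * (q * y) / (Q * E * R)
            * ((1 - b / q) * X * (Z * (1 - c * y) * (1 - c * q * y) * (1 - c * q ^ 2 * y) * (1 - c * q ^ 3 * y) / D)
               - c * q / b * (X * (1 - b * y) * (1 - b * q * y) * (1 - b * q ^ 2 * y)) * (Z * (1 - c * y)) * (1 / ((1 - c * q) * (1 - c * q ^ 2))))"
      by (simp add: R_def mult_ac)
    also have "\<dots> = ?C * (y * ((q - b) * b * (1 - c * q * y) * (1 - c * q ^ 2 * y) * (1 - c * q ^ 3 * y)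
      - c * q ^ 2 * (1 - b * y) * (1 - b * q * y) * (1 - b * q ^ 2 * y) * (1 - c)))"
      unfolding cc using \<open>q \<noteq> 0\<close> \<open>b \<noteq> 0\<close> D Q E R by (simp add: divide_simps) algebra
    finally show ?thesis .
  qed
  have t2: "(1 - c * q / b) * A / (Q * E) * X * (Z * (1 - c * y)) / D = ?C * ((b - c * q) * R)"
    using \<open>b \<noteq> 0\<close> D Q E R by (simp add: divide_simps)
  have t3: "(1 - c * q / b) * (A * (1 - a * q ^ 3 * y ^ 3)) / (Q * (1 - q * y) * (E * (1 - a * y ^ 2) * (1 - a * q * y ^ 2)))
       * (X * (1 - b * y)) * (Z * (1 - c * y) * (1 - c * q * y)) / D
     = ?C * ((b - c * q) * (1 - a * q ^ 3 * y ^ 3) * (1 - b * y) * (1 - c * q * y))"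
  proof -
    have "Q * (1 - q * y) * (E * (1 - a * y ^ 2) * (1 - a * q * y ^ 2)) = Q * E * R"
      by (simp add: R_def)
    thus ?thesis
      using \<open>b \<noteq> 0\<close> D Q E R by (simp add: divide_simps)
  qed
  show ?case
    unfolding sum.atMost_Suc Suc.IH e1 e2 e3 e4 e4' e5 e6 e7
      A_def [symmetric] D_def [symmetric] Q_def [symmetric] E_def [symmetric] X_def [symmetric]
      power_Suc[of q m] y_def [symmetric] t1 t2 t3
    by (simp only: key [symmetric] distrib_left)
qed

lemma qprod_neg_power_eq_0:
  assumes "q \<noteq> 0" "n < k"
  shows "qprod (q powi (- int n)) q k = 0"
  unfolding qprod_eq_0_iff using assms
  by (intro exI[of _ n]) (simp add: power_int_minus)

text \<open>Strong induction from \<open>p - 3\<close> to \<open>p\<close> by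
  \<open>cubic_telescope\<close>. Terms with \<open>k > p\<close> vanish, so any upper limit
  \<open>M\<close> with \<open>p \<le> M\<close> gives the same sum; thus sums for different
  \<open>p\<close> can share one range.\<close>

lemma cubic_sum:
  assumes "q \<noteq> 0" "a \<noteq> 0"
    and q: "\<And>k. q ^ Suc k \<noteq> 1" and a: "\<And>j. a * q powi j \<noteq> 1"
    and "p \<le> M"
  shows "(\<Sum>k\<le>M. qprod a (q ^ 3) k * q ^ k / (qprod q q k * qprod a q (2 * k))
            * (qprod (q powi (- int p)) q k * qprod (q powi (int p) * a) q k))
         = (if 3 dvd p then a ^ (p div 3) * (qprod q (q ^ 3) (p div 3) * qprod (q ^ 2) (q ^ 3) (p div 3))
              / (qprod (q * a) (q ^ 3) (p div 3) * qprod (q ^ 2 * a) (q ^ 3) (p div 3)) else 0)"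
  using \<open>p \<le> M\<close>
proof (induction p rule: less_induct)
  case (less p)
  define w where "w k = qprod a (q ^ 3) k * q ^ k / (qprod q q k * qprod a q (2 * k))" for k
  define S where "S p = (\<Sum>k\<le>M. w k * (qprod (q powi (- int p)) q k * qprod (q powi (int p) * a) q k))" for p
  define V where "V m = a ^ m * (qprod q (q ^ 3) m * qprod (q ^ 2) (q ^ 3) m)
              / (qprod (q * a) (q ^ 3) m * qprod (q ^ 2 * a) (q ^ 3) m)" for m
  have IH: "S r = (if 3 dvd r then V (r div 3) else 0)" if "r < p" for r
    using less.IH[OF that] less.prems that by (simp add: S_def V_def w_def)
  have "S p = (if 3 dvd p then V (p div 3) else 0)"
  proof (cases "p = 0")
    case True
    have "qprod 1 q k = (if k = 0 then 1 else 0)" for k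
      using qprod_neg_power_eq_0[OF \<open>q \<noteq> 0\<close>, of 0 k] by auto
    hence "S p = (\<Sum>k\<le>M. if k = 0 then 1 else 0)"
      unfolding S_def True by (intro sum.cong) (auto simp: w_def)
    thus ?thesis by (simp add: True V_def)
  next
    case False
    define b c where "b = q powi (1 - int p)" and "c = q powi (int p - 3) * a"
    have cq: "c * q ^ i = a * q powi (int p - 3 + int i)" for i
      using \<open>q \<noteq> 0\<close> by (simp add: c_def power_int_add mult_ac)
    have bc: "a = b * c * q ^ 2"
      using \<open>q \<noteq> 0\<close> by (simp add: mult.assoc cq) (simp add: b_def c_def mult_ac flip: power_int_add)
    have c_ne: "c * q ^ i \<noteq> 1" for i
      unfolding cq by (rule a)
    \<comment> \<open>The boundary term left by the telescoping contains this product. Since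
      \<open>b\<close> is \<open>q\<close> to the power \<open>-(p - 1)\<close> and
      \<open>p - 1 < M\<close>, it is zero.\<close>
    have bM: "qprod b q M = 0"
    proof -
      have "b = q powi (- int (p - 1))" using False by (simp add: b_def of_nat_diff)
      thus ?thesis using qprod_neg_power_eq_0[of q "p - 1" M] False less.prems \<open>q \<noteq> 0\<close> by simp
    qed
    have tel: "(\<Sum>k\<le>M. w k * (qprod (b / q) q k * qprod (c * q ^ 3) q k
               - c * q / b * qprod b q (k + 2) * qprod c q k / ((1 - c * q) * (1 - c * q ^ 2)))) = 0"
      unfolding w_def
      using cubic_telescope[OF bc _ \<open>q \<noteq> 0\<close> q, of M] a[of "int _"] c_ne[of 0] c_ne[of 1] c_ne[of 2] \<open>q \<noteq> 0\<close>
      by (simp add: bM) (simp add: b_def)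
    have "b / q = q powi (- int p)" "c * q ^ 3 = q powi (int p) * a"
      using \<open>q \<noteq> 0\<close> by (simp_all add: cq) (simp_all add: b_def power_int_diff power_int_minus field_simps)
    hence S_eq: "S p = (\<Sum>k\<le>M. w k * (c * q / b * qprod b q (k + 2) * qprod c q k / ((1 - c * q) * (1 - c * q ^ 2))))"
      using tel by (simp add: S_def right_diff_distrib sum_subtractf)
    show ?thesis
    proof (cases "p < 3")
      case True
      \<comment> \<open>For \<open>p = 1\<close> or \<open>p = 2\<close> the zero factor has index
        \<open>p - 1\<close>, hence is among the first two and present for every \<open>k\<close>.
        So the sum is zero.\<close>
      hence "qprod b q (k + 2) = 0" for k
        using False \<open>q \<noteq> 0\<close> unfolding qprod_eq_0_iff b_def
        by (intro exI[of _ "p - 1"]) (auto simp: of_nat_diff simp flip: power_int_of_nat power_int_add)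
      moreover have "\<not> 3 dvd p" using True False by (auto dest: dvd_imp_le)
      ultimately show ?thesis by (simp add: S_eq)
    next
      case p3: False
      define r where "r = p - 3"
      have p: "p = r + 3" using p3 by (simp add: r_def)
      have c': "c = q powi (int r) * a" by (simp add: c_def p)
      have b': "b * q ^ 2 = q powi (- int r)" "b \<noteq> 0"
        using \<open>q \<noteq> 0\<close> power_int_add[of q "- 2 - int r" 2] by (simp_all add: b_def p)
      have bb: "b = 1 / (q ^ r * q ^ 2)"
        using b' \<open>q \<noteq> 0\<close> by (simp add: power_int_minus field_simps)
      \<comment> \<open>Splitting off two factors leaves the product belonging to
        \<open>r = p - 3\<close>; the two factors become the numerator of the ratio between the sums
        for \<open>p\<close> and \<open>r\<close>.\<close>
      have "qprod b q (k + 2) = (1 - b) * (1 - b * q) * qprod (q powi (- int r)) q k" for k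
        by (simp add: b'(1)[symmetric] qprod_Suc_left power2_eq_square mult_ac)
      hence "S p = c * q / b * (1 - b) * (1 - b * q) / ((1 - c * q) * (1 - c * q ^ 2)) * S r"
        unfolding S_eq S_def[of r] c'[symmetric] sum_distrib_left by (intro sum.cong) auto
      also have "c * q / b * (1 - b) * (1 - b * q) = a * (1 - q ^ (r + 1)) * (1 - q ^ (r + 2))"
        unfolding c' bb using \<open>q \<noteq> 0\<close> by (simp add: field_simps power2_eq_square)
      also have "(1 - c * q) * (1 - c * q ^ 2) = (1 - q ^ (r + 1) * a) * (1 - q ^ (r + 2) * a)"
        by (simp add: c' mult_ac power2_eq_square)
      also have "S r = (if 3 dvd r then V (r div 3) else 0)"
        by (rule IH) (simp add: p)
      also have "a * (1 - q ^ (r + 1)) * (1 - q ^ (r + 2)) / ((1 - q ^ (r + 1) * a) * (1 - q ^ (r + 2) * a)) * \<dots>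
           = (if 3 dvd p then V (p div 3) else 0)"
      proof (cases "3 dvd r")
        case True
        \<comment> \<open>For \<open>r = 3 * m\<close> the exponents \<open>r + 1\<close> and
          \<open>r + 2\<close> give precisely the factors with index \<open>m\<close> of the
          products in base \<open>q ^ 3\<close>.\<close>
        then obtain m where m: "r = 3 * m" by blast
        have "p div 3 = Suc m" "3 dvd p" "r div 3 = m" by (simp_all add: p m)
        thus ?thesis using True
          by (simp add: V_def qprod_Suc m power_mult [symmetric] power2_eq_square mult_ac)
      qed (simp add: p)
      finally show ?thesis .
    qed
  qed
  thus ?case by (simp add: S_def V_def w_def)
qed

section \<open>Connection coefficients for pairs of q-products\<close>

text \<open>At \<open>u = q ^ n\<close> this is the prefactor of the right-hand side times its
  summand of index \<open>i\<close>, stripped of the value of the sum for \<open>n - i\<close>. The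
  parameter \<open>u\<close> stays free because the recurrence in \<open>l\<close> replaces it by
  \<open>u / q\<close>. The exponent is an integer since \<open>i = l + 1\<close> also
  occurs.\<close>

definition expansion_coeff :: "complex \<Rightarrow> complex \<Rightarrow> complex \<Rightarrow> nat \<Rightarrow> nat \<Rightarrow> complex" where
  "expansion_coeff q a u l i =
     qprod (u * a / q ^ l) q l / qprod (u ^ 2 * a / q ^ l) q l
     * ((a * u ^ 2) ^ i * q powi ((int l - int i) * int i))
     * ((1 - q ^ (2 * i) / (u ^ 2 * a)) / (1 - 1 / (u ^ 2 * a)))
     * (qprod (1 / q ^ l) q i * qprod (1 / u) q i * qprod (1 / (u ^ 2 * a)) q i)
     / (qprod q q i * qprod (q ^ Suc l / (u ^ 2 * a)) q i * qprod (u * a / q ^ i) q i)"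


text \<open>This is what remains of \<open>expansion_coeff_Suc\<close> after its common factor is
  removed, with \<open>A = 1 / (u ^ 2 * a)\<close>, \<open>L = q ^ l\<close> and
  \<open>J = q ^ j\<close>.\<close>

lemma coeff_rational_identity:
  fixes A J L q :: complex
  assumes "A \<noteq> 0" "J \<noteq> 0" "L \<noteq> 0" "q \<noteq> 0"
    "1 - q * J * A \<noteq> 0" "1 - q * J \<noteq> 0" "q * L * A \<noteq> 1" "q ^ 2 * L * A \<noteq> 1" "1 - q ^ 2 * A \<noteq> 0"
  shows "1 / (1 - 1 / (q * L * A)) * (L / J / A) * (1 - 1 / (q * L)) / ((1 - q * J * A) * (1 - q * J) * (1 - q ^ 2 * L * A))
    = 1 / (1 - 1 / (q * L * A)) * (L / J / A / (q * J)) * (1 - J / L) * (1 - q ^ 2 * L * J * A) / ((1 - q * J * A) * (1 - q * J) * (1 - q * L * A) * (1 - q ^ 2 * L * A))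
    + 1 / (1 - q * L * A) * (- 1 / (q * A)) * (1 - 1 / (q ^ 2 * A)) / ((1 - 1 / (q * L * A)) * (1 - 1 / (q ^ 2 * L * A)) * (1 - q ^ 2 * A)) / J ^ 2"
proof -
  have e: "1 - 1 / (q * L * A) = - (1 - q * L * A) / (q * L * A)"
     "1 - 1 / (q ^ 2 * L * A) = - (1 - q ^ 2 * L * A) / (q ^ 2 * L * A)"
     "1 - 1 / (q ^ 2 * A) = - (1 - q ^ 2 * A) / (q ^ 2 * A)"
    using assms by (simp_all add: field_simps)
  \<comment> \<open>The denominators are kept as single letters while fractions are cleared;
    expanding them afterwards leaves a polynomial identity.\<close>
  define x y z t s where "x = 1 - q * J * A" and "y = 1 - q * J" and "z = 1 - q * L * A" and "t = 1 - q ^ 2 * L * A" and "s = 1 - q ^ 2 * A"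
  have ne: "x \<noteq> 0" "y \<noteq> 0" "z \<noteq> 0" "t \<noteq> 0" "s \<noteq> 0" using assms by (auto simp: x_def y_def z_def t_def s_def)
  show ?thesis
    unfolding e x_def [symmetric] y_def [symmetric] z_def [symmetric] t_def [symmetric] s_def [symmetric]
    using ne assms(1-4)
    by (simp add: divide_simps) (simp only: x_def y_def z_def t_def s_def, algebra)
qed



text \<open>A Pascal-type rule. Its two weights are those of \<open>qprod_pair_recurrence\<close>
  for \<open>U = 1 / u\<close> and \<open>V = u * a / q ^ Suc l\<close>.\<close>

lemma expansion_coeff_Suc:
  assumes "q \<noteq> 0" "a \<noteq> 0" "u \<noteq> 0"
    and q: "\<And>k. q ^ Suc k \<noteq> 1"
    and ua: "\<And>j. u * a * q powi j \<noteq> 1" and uua: "\<And>j. u ^ 2 * a * q powi j \<noteq> 1"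
  shows "expansion_coeff q a u (Suc l) (Suc j) =
      (1 - u * a / q ^ Suc l) / (1 - u ^ 2 * a / q ^ Suc l) * expansion_coeff q a u l (Suc j)
      + (1 - 1 / u) / (1 - q ^ Suc l / (u ^ 2 * a)) * expansion_coeff q a (u / q) l j"
proof -
  define A L J where "A = 1 / (u ^ 2 * a)" and "L = q ^ l" and "J = q ^ j"
  define B D where "B = (a * u ^ 2) ^ j" and "D = q powi ((int l - int j) * int j)"
  define p s f where "p = qprod (u * a / q ^ l) q l" and "s = qprod (u ^ 2 * a / q ^ l) q l"
    and "f = qprod (1 / q ^ l) q j"
  define g h d where "g = qprod (q / u) q j" and "h = qprod (q ^ 2 * A) q j" and "d = qprod q q j"
  define m e where "m = qprod (q ^ 3 * L * A) q j" and "e = qprod (u * a / q ^ Suc j) q j"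
  note [simp] = assms(1-3)
  have ne [simp]: "A \<noteq> 0" "L \<noteq> 0" "J \<noteq> 0"
    by (auto simp: A_def L_def J_def)
  have Aq: "q powi i * A \<noteq> 1" for i
    using uua[of "- i"] by (auto simp: A_def power_int_minus field_simps)
  have AqN: "q ^ i * A \<noteq> 1" for i
    using Aq[of "int i"] by simp
  have uua': "u ^ 2 * a = 1 / A" by (simp add: A_def)
  have r_ne: "1 - u * a / q \<noteq> 0" using ua[of "- 1"] by (simp add: field_simps)
  have x0: "1 - A \<noteq> 0" using Aq[of 0] by simp
  have x1: "1 - q * A \<noteq> 0" using Aq[of 1] by simp
  have x4: "1 - q ^ 2 * A \<noteq> 0" using Aq[of 2] by simp
  have x3: "1 - q * J * A \<noteq> 0" using AqN[of "Suc j"] by (simp add: J_def)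
  have y: "1 - q * J \<noteq> 0" using q[of j] by (simp add: J_def)
  have z1: "q * L * A \<noteq> 1" using AqN[of "Suc l"] by (simp add: L_def)
  have z2: "q ^ 2 * L * A \<noteq> 1" using AqN[of "Suc (Suc l)"] by (simp add: L_def power2_eq_square mult_ac)
  have z3: "1 - q ^ 2 * L * J * A \<noteq> 0" using AqN[of "l + j + 2"]
    by (simp add: L_def J_def power2_eq_square power_add mult_ac)
  have p1: "qprod (u * a / q ^ Suc l) q (Suc l) = (1 - u * a / q ^ Suc l) * p"
    by (simp add: qprod_Suc_left p_def)
  \<comment> \<open>One product of \<open>l + 1\<close> factors is split at its first and at its
    last factor, which relates the blocks for \<open>u / q\<close> and \<open>u\<close>. The same
    two-way splitting gives \<open>s3\<close>, \<open>h1\<close> and \<open>m2\<close>.\<close>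
  have "(1 - u * a / q ^ Suc l) * p = qprod (u / q * a / q ^ l) q l * (1 - u * a / q)"
    unfolding p1 [symmetric] by (simp add: qprod_Suc)
  hence p3: "qprod (u / q * a / q ^ l) q l = (1 - u * a / q ^ Suc l) * p / (1 - u * a / q)"
    using r_ne by (simp add: eq_divide_eq)
  have s1: "qprod (u ^ 2 * a / q ^ Suc l) q (Suc l) = (1 - 1 / (q * L * A)) * s"
    by (simp add: qprod_Suc_left s_def A_def L_def)
  have "(1 - 1 / (q ^ 2 * L * A)) * (1 - 1 / (q * L * A)) * s = qprod ((u / q) ^ 2 * a / q ^ l) q (Suc (Suc l))"
    by (simp add: qprod_Suc_left s_def A_def L_def power2_eq_square mult_ac)
  also have "\<dots> = qprod ((u / q) ^ 2 * a / q ^ l) q l * (1 - 1 / (q ^ 2 * A)) * (1 - 1 / (q * A))"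
    by (simp add: qprod_Suc A_def power2_eq_square mult_ac)
  finally have s3: "qprod ((u / q) ^ 2 * a / q ^ l) q l = (1 - 1 / (q * L * A)) * (1 - 1 / (q ^ 2 * L * A)) * s
      / (- (1 - q * A) / (q * A) * (1 - 1 / (q ^ 2 * A)))"
    using x1 x4 by (simp add: eq_divide_eq mult_ac) (simp add: field_simps)
  have f1: "qprod (1 / q ^ Suc l) q (Suc j) = (1 - 1 / (q * L)) * f"
    by (simp add: qprod_Suc_left f_def L_def)
  have f2: "qprod (1 / q ^ l) q (Suc j) = f * (1 - J / L)"
    by (simp add: qprod_Suc f_def L_def J_def)
  have g1: "qprod (1 / u) q (Suc j) = (1 - 1 / u) * g"
    by (simp add: qprod_Suc_left g_def)
  have "qprod A q (Suc j) * (1 - q * J * A) = qprod A q (Suc (Suc j))"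
    by (simp add: qprod_Suc J_def mult_ac)
  also have "\<dots> = (1 - A) * (1 - q * A) * h"
    by (simp add: qprod_Suc_left h_def mult_ac power2_eq_square)
  finally have h1: "qprod A q (Suc j) = (1 - A) * (1 - q * A) * h / (1 - q * J * A)"
    using x3 by (simp add: eq_divide_eq)
  have d1: "qprod q q (Suc j) = d * (1 - q * J)"
    by (simp add: qprod_Suc d_def J_def)
  have m1: "qprod (q ^ Suc (Suc l) * A) q (Suc j) = (1 - q ^ 2 * L * A) * m"
    by (simp add: qprod_Suc_left m_def L_def power2_eq_square power3_eq_cube mult_ac)
  have "qprod (q ^ Suc l * A) q (Suc j) * (1 - q ^ 2 * L * J * A) = qprod (q ^ Suc l * A) q (Suc (Suc j))"
    by (simp add: qprod_Suc L_def J_def power2_eq_square mult_ac)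
  also have "\<dots> = (1 - q * L * A) * (1 - q ^ 2 * L * A) * m"
    by (simp add: qprod_Suc_left m_def L_def power2_eq_square power3_eq_cube mult_ac)
  finally have m2: "qprod (q ^ Suc l * A) q (Suc j) = (1 - q * L * A) * (1 - q ^ 2 * L * A) * m / (1 - q ^ 2 * L * J * A)"
    using z3 by (simp add: eq_divide_eq)
  have e1: "qprod (u * a / q ^ Suc j) q (Suc j) = e * (1 - u * a / q)"
    by (simp add: qprod_Suc e_def)
  have B1: "(a * u ^ 2) ^ Suc j = B / A" by (simp add: B_def A_def)
  have B3: "(a * (u / q) ^ 2) ^ j = B / J ^ 2"
    by (simp add: B_def J_def power_divide power_mult_distrib power2_eq_square)
  have D1: "q powi ((int (Suc l) - int (Suc j)) * int (Suc j)) = D * L / J"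
    by (simp add: D_def L_def J_def distrib_left power_int_add power_int_diff)
  have D2: "q powi ((int l - int (Suc j)) * int (Suc j)) = D * L / J / (q * J)"
  proof -
    have "(int l - int (Suc j)) * int (Suc j) = (int l - int j) * int j + (int l - int j - int (Suc j))"
      by (simp add: algebra_simps)
    thus ?thesis
      by (simp only: power_int_add power_int_diff power_int_of_nat assms(1) not_False_eq_True simp_thms)
         (simp add: D_def L_def J_def power_int_diff)
  qed
  have J2: "q ^ (2 * Suc j) = q ^ 2 * J ^ 2" "q ^ (2 * j) = J ^ 2"
    by (simp_all add: J_def power_mult power_mult_distrib power2_eq_square mult_ac power_add)
  have Aeq: "x / (u ^ 2 * a) = x * A" for x by (simp add: A_def)
  have Aeq': "x / ((u / q) ^ 2 * a) = x * q ^ 2 * A" for x by (simp add: A_def field_simps)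
  have m3: "qprod (q ^ Suc l * q ^ 2 * A) q j = m"
    by (simp add: m_def L_def power2_eq_square power3_eq_cube mult_ac)
  have e3: "qprod (u / q * a / q ^ j) q j = e" by (simp add: e_def)
  have g3: "qprod (1 / (u / q)) q j = g" by (simp add: g_def)
  have V2: "u ^ 2 * a / q ^ Suc l = 1 / (q * L * A)" by (simp add: uua' L_def)
  \<comment> \<open>The factor common to all three coefficients; the cofactors in \<open>c1\<close>,
    \<open>c2\<close> and \<open>c3\<close> are the terms of
    \<open>coeff_rational_identity\<close>.\<close>
  define K where "K = p / s * B * D * (1 - q ^ 2 * J ^ 2 * A) * f * g * h / (d * m * e * (1 - u * a / q))
     * (1 - u * a / q ^ Suc l) * (1 - 1 / u) * (1 - q * A)"
  have c1: "expansion_coeff q a u (Suc l) (Suc j) = K *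
     (1 / (1 - 1 / (q * L * A)) * (L / J / A) * (1 - 1 / (q * L)) / ((1 - q * J * A) * (1 - q * J) * (1 - q ^ 2 * L * A)))"
    unfolding expansion_coeff_def p1 s1 B1 D1 J2 f1 g1 d1 e1 Aeq mult_1 h1 m1 K_def
    using x0 by (simp add: mult_ac)
  have c2: "(1 - u * a / q ^ Suc l) / (1 - u ^ 2 * a / q ^ Suc l) * expansion_coeff q a u l (Suc j) = K *
     (1 / (1 - 1 / (q * L * A)) * (L / J / A / (q * J)) * (1 - J / L) * (1 - q ^ 2 * L * J * A)
       / ((1 - q * J * A) * (1 - q * J) * (1 - q * L * A) * (1 - q ^ 2 * L * A)))"
    unfolding expansion_coeff_def V2 p_def [symmetric] s_def [symmetric] B1 D2 J2 f2 g1 d1 e1 Aeq mult_1 h1 m2 K_def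
    using x0 by (simp add: mult_ac)
  define X where "X = 1 - q * A"
  have c3: "(1 - 1 / u) / (1 - q ^ Suc l / (u ^ 2 * a)) * expansion_coeff q a (u / q) l j = K *
     (1 / (1 - q * L * A) * (- 1 / (q * A)) * (1 - 1 / (q ^ 2 * A))
       / ((1 - 1 / (q * L * A)) * (1 - 1 / (q ^ 2 * L * A)) * (1 - q ^ 2 * A)) / J ^ 2)"
    unfolding expansion_coeff_def p3 s3 B3 D_def [symmetric] J2 f_def [symmetric] g3 d_def [symmetric] e3 Aeq Aeq' mult_1
      h_def [symmetric] m3 K_def X_def [symmetric] by (simp add: L_def mult_ac)
  show ?thesis
    unfolding c1 c2 c3
    using coeff_rational_identity[OF ne(1,3,2) assms(1) x3 y z1 z2 x4] by (simp only: distrib_left)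
qed

text \<open>Once the common factors are taken out, this is Lagrange interpolation of the constant 1
  at the nodes \<open>1 / U\<close> and \<open>1 / V\<close>, evaluated at \<open>q ^ k\<close>.
  Taking them out uses products with \<open>k - 1\<close> factors, so \<open>k = 0\<close> is
  treated separately.\<close>

lemma qprod_pair_recurrence:
  assumes "U \<noteq> V" "U \<noteq> 0" "V \<noteq> 0"
  shows "qprod U q k * qprod V q k =
     (1 - V) / (1 - V / U) * (qprod U q k * qprod (V * q) q k)
     + (1 - U) / (1 - U / V) * (qprod (U * q) q k * qprod V q k)"
proof (cases k)
  case (Suc j)
  have "qprod U q k = (1 - U) * qprod (U * q) q j" "qprod V q k = (1 - V) * qprod (V * q) q j"
    "qprod (U * q) q k = qprod (U * q) q j * (1 - U * q ^ k)"
    "qprod (V * q) q k = qprod (V * q) q j * (1 - V * q ^ k)"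
    unfolding Suc by (simp only: qprod_Suc_left, simp only: qprod_Suc_left, simp_all add: qprod_Suc mult_ac)
  note eqs = this
  have "1 = (1 - V * y) / (1 - V / U) + (1 - U * y) / (1 - U / V)" for y
    using assms by (simp add: divide_simps) (simp add: algebra_simps)
  hence "X = (1 - V * q ^ k) / (1 - V / U) * X + (1 - U * q ^ k) / (1 - U / V) * X" for X
    by (metis distrib_right mult_1)
  from this[of "(1 - U) * (1 - V) * qprod (U * q) q j * qprod (V * q) q j"]
  show ?thesis by (simp add: eqs mult_ac)
next
  case 0
  have "1 = (1 - V) / (1 - V / U) + (1 - U) / (1 - U / V)"
    using assms by (simp add: divide_simps) (simp add: algebra_simps)
  thus ?thesis by (simp add: 0)
qed

text \<open>Induction on \<open>l\<close> for all \<open>u\<close> at once: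
  \<open>qprod_pair_recurrence\<close> reduces the pair for \<open>(u, Suc l)\<close> to those for
  \<open>(u, l)\<close> and \<open>(u / q, l)\<close>.\<close>

lemma qprod_pair_expansion:
  assumes "q \<noteq> 0" "a \<noteq> 0" "u \<noteq> 0"
    and q: "\<And>k. q ^ Suc k \<noteq> 1"
    and "\<And>j. u * a * q powi j \<noteq> 1" and "\<And>j. u ^ 2 * a * q powi j \<noteq> 1"
  shows "qprod (1 / u) q k * qprod (u * a / q ^ l) q k =
     (\<Sum>i\<le>l. expansion_coeff q a u l i * (qprod (q ^ i / u) q k * qprod (u * a / q ^ i) q k))"
  using assms(3,5,6)
proof (induction l arbitrary: u)
  case 0
  have "u ^ 2 * a \<noteq> 1" using 0(3)[of 0] by simp
  thus ?case using 0 \<open>a \<noteq> 0\<close> by (simp add: expansion_coeff_def)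
next
  case (Suc l)
  define G where "G i = qprod (q ^ i / u) q k * qprod (u * a / q ^ i) q k" for i
  define \<alpha> \<beta> where "\<alpha> = (1 - u * a / q ^ Suc l) / (1 - u ^ 2 * a / q ^ Suc l)"
    and "\<beta> = (1 - 1 / u) / (1 - q ^ Suc l / (u ^ 2 * a))"
  have uq: "u / q \<noteq> 0" using Suc.prems assms(1) by simp
  have g1: "u / q * a * q powi j \<noteq> 1" for j
    using Suc.prems(2)[of "j - 1"] assms(1) by (simp add: power_int_diff)
  have g2: "(u / q) ^ 2 * a * q powi j \<noteq> 1" for j
    using Suc.prems(3)[of "j - 2"] assms(1) by (simp add: power_int_diff power_divide)
  have ne: "1 / u \<noteq> u * a / q ^ Suc l"
    using Suc.prems(3)[of "- int (Suc l)", unfolded power_int_minus power_int_of_nat]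
      Suc.prems(1) assms(1)
    by (simp add: divide_simps power2_eq_square mult_ac)
  have rec: "qprod (1 / u) q k * qprod (u * a / q ^ Suc l) q k =
      \<alpha> * (qprod (1 / u) q k * qprod (u * a / q ^ l) q k)
      + \<beta> * (qprod (1 / (u / q)) q k * qprod (u / q * a / q ^ l) q k)"
    using qprod_pair_recurrence[OF ne, of q k] Suc.prems(1) assms(1,2)
    by (simp add: \<alpha>_def \<beta>_def power2_eq_square mult_ac)
  \<comment> \<open>The product starting at \<open>1 / q ^ l\<close> has a zero factor when its
    length is \<open>Suc l\<close>; hence the sum for \<open>(u, l)\<close> may be extended to
    \<open>Suc l\<close>.\<close>
  have top: "expansion_coeff q a u l (Suc l) = 0"
    using qprod_neg_power_eq_0[of q l "Suc l"] assms(1)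
    by (simp add: expansion_coeff_def power_int_minus divide_inverse)
  have bot: "expansion_coeff q a u (Suc l) 0 = \<alpha> * expansion_coeff q a u l 0"
    using Suc.prems(1) assms(1,2) by (simp add: expansion_coeff_def \<alpha>_def qprod_Suc_left)
  \<comment> \<open>Passing from \<open>u\<close> to \<open>u / q\<close> shifts the index of the
    pair by one, which produces the second summand in the Pascal rule.\<close>
  have G': "qprod (q ^ i / (u / q)) q k * qprod (u / q * a / q ^ i) q k = G (Suc i)" for i
    by (simp add: G_def mult_ac)
  have "qprod (1 / u) q k * qprod (u * a / q ^ Suc l) q k =
      \<alpha> * (\<Sum>i\<le>Suc l. expansion_coeff q a u l i * G i) + \<beta> * (\<Sum>i\<le>l. expansion_coeff q a (u / q) l i * G (Suc i))"
    unfolding rec Suc.IH[OF uq g1 g2] Suc.IH[OF Suc.prems] G'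
    by (simp add: top G_def)
  also have "\<dots> = expansion_coeff q a u (Suc l) 0 * G 0 +
      (\<Sum>i\<le>l. (\<alpha> * expansion_coeff q a u l (Suc i) + \<beta> * expansion_coeff q a (u / q) l i) * G (Suc i))"
    unfolding sum.atMost_Suc_shift bot
    by (simp add: sum_distrib_left distrib_left distrib_right sum.distrib mult_ac)
  also have "\<dots> = (\<Sum>i\<le>Suc l. expansion_coeff q a u (Suc l) i * G i)"
    unfolding sum.atMost_Suc_shift \<alpha>_def \<beta>_def
    using expansion_coeff_Suc[OF assms(1,2) Suc.prems(1) q Suc.prems(2,3)] by simp
  finally show ?case by (simp add: G_def)
qed

section \<open>Continuity and approximation by generic parameters\<close>

text \<open>A finite product of continuous factors; for negative \<open>m\<close> the hypothesis
  \<open>qpoch_defined\<close> keeps the limit of the denominator away from zero.\<close>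

lemma qpoch_tendsto:
  assumes "(x \<longlongrightarrow> x0) F" "(q \<longlongrightarrow> q0) F" "q0 \<noteq> 0" "qpoch_defined x0 q0 m"
  shows "((\<lambda>t. qpoch (x t) (q t) m) \<longlongrightarrow> qpoch x0 q0 m) F"
proof (cases "m \<ge> 0")
  case True
  thus ?thesis unfolding qpoch_def using assms
    by (auto intro!: tendsto_intros)
next
  case False
  have "(\<Prod>j\<in>{m..<0}. 1 - x0 * q0 powi j) \<noteq> 0"
    using assms(4) unfolding qpoch_defined_def by simp
  thus ?thesis unfolding qpoch_def using assms False
    by (auto intro!: tendsto_intros)
qed

lemma qpoch_defined_of_nat: "qpoch_defined x q (int k)"
  by (simp add: qpoch_defined_def)

text \<open>Each ball around \<open>z\<close> is uncountable, so it contains an admissible point.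
  The excluded set may vary with the index, as is needed when it depends on another
  sequence.\<close>

lemma sequence_avoiding_countable_sets:
  fixes z :: complex and S :: "nat \<Rightarrow> complex set"
  assumes "\<And>t. countable (S t)"
  obtains f where "f \<longlonglongrightarrow> z" and "\<And>t. f t \<notin> S t"
proof -
  have "\<exists>w \<in> ball z (1 / real (Suc t)). w \<notin> S t" for t
    using uncountable_ball[of "1 / real (Suc t)" z] assms[of t] countable_subset
    by (metis of_nat_0_less_iff subsetI zero_less_Suc zero_less_divide_1_iff)
  then obtain f where f: "\<And>t. f t \<in> ball z (1 / real (Suc t))" "\<And>t. f t \<notin> S t"
    by metis
  have "f \<longlonglongrightarrow> z"
    using f(1) by (intro LIMSEQ_norm_0[THEN LIM_zero_cancel]) (simp add: dist_norm norm_minus_commute)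
  thus thesis using f(2) that by blast
qed

text \<open>First \<open>qs\<close> is chosen off zero and the roots of unity, then
  \<open>as t\<close> off zero and the integer powers of \<open>qs t\<close>; all these sets are
  countable.\<close>

lemma generic_sequences:
  fixes a q :: complex
  obtains as qs where "as \<longlonglongrightarrow> a" "qs \<longlonglongrightarrow> q" "\<And>t. as t \<noteq> 0" "\<And>t. qs t \<noteq> 0"
    "\<And>t k. qs t ^ Suc k \<noteq> 1" "\<And>t j. as t * qs t powi j \<noteq> 1"
proof -
  have "finite {z :: complex. z ^ Suc k = 1}" for k
    by (rule finite_roots_unity) simp
  hence "countable (insert 0 (\<Union>k. {z :: complex. z ^ Suc k = 1}))"
    by (intro countable_insert countable_UN) (auto intro: countable_finite)
  then obtain qs where qs: "qs \<longlonglongrightarrow> q" "\<And>t. qs t \<notin> insert 0 (\<Union>k. {z. z ^ Suc k = 1})"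
    using sequence_avoiding_countable_sets[of "\<lambda>_. insert 0 (\<Union>k. {z. z ^ Suc k = 1})" q] by blast
  have "countable (insert 0 (range (\<lambda>j :: int. inverse (qs t powi j))))" for t
    by simp
  then obtain as where as: "as \<longlonglongrightarrow> a" "\<And>t. as t \<notin> insert 0 (range (\<lambda>j :: int. inverse (qs t powi j)))"
    using sequence_avoiding_countable_sets[of "\<lambda>t. insert 0 (range (\<lambda>j :: int. inverse (qs t powi j)))" a] by blast
  have "as t * qs t powi j \<noteq> 1" for t j
    using as(2)[of t] by (metis insert_iff inverse_inverse_eq inverse_unique rangeI)
  thus thesis using that as qs by auto
qed

section \<open>Summands of both sides, and the identity for generic parameters\<close>

text \<open>The square roots are replaced by products in base \<open>q ^ 2\<close>, so that limits
  in \<open>a\<close> and \<open>q\<close> require no choice of a branch.\<close>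

definition lhs_term :: "nat \<Rightarrow> nat \<Rightarrow> complex \<Rightarrow> complex \<Rightarrow> nat \<Rightarrow> complex" where
  "lhs_term n l a q k =
     qpoch a (q ^ 3) (int k)
     * ((qpoch (q powi (- int n)) q (int k) * qpoch (q powi (int n - int l) * a) q (int k))
        / (qpoch q q (int k) * qpoch a (q ^ 2) (int k) * qpoch (q * a) (q ^ 2) (int k)))
     * q ^ k"

definition rhs_term :: "nat \<Rightarrow> nat \<Rightarrow> complex \<Rightarrow> complex \<Rightarrow> nat \<Rightarrow> complex" where
  "rhs_term n l a q i =
     a powi ((int n + 2 * int i) div 3)
     * q powi ((int l + 2 * int n - int i) * int i)
     * ((a - q powi (2 * int i - 2 * int n)) / (a - q powi (- 2 * int n)))
     * ((qpoch (q powi (- int l)) q (int i) * qpoch (q powi (- int n)) q (int i)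
         * qpoch (q powi (- 2 * int n) / a) q (int i))
        / (qpoch q q (int i) * qpoch (q powi (1 + int l - 2 * int n) / a) q (int i)
           * qpoch (q powi (int n - int i) * a) q (int i)))
     * ((qpoch q (q ^ 3) ((int n - int i) div 3)
         * qpoch (q ^ 2) (q ^ 3) ((int n - int i) div 3))
        / (qpoch (q * a) (q ^ 3) ((int n - int i) div 3)
           * qpoch (q ^ 2 * a) (q ^ 3) ((int n - int i) div 3)))
     * chi (int n - int i)"

lemma lhs_term_tendsto:
  assumes "(as \<longlongrightarrow> a) F" "(qs \<longlongrightarrow> q) F" "q \<noteq> 0"
    and "qpoch q q (int k) \<noteq> 0" "qpoch a (q ^ 2) (int k) \<noteq> 0" "qpoch (q * a) (q ^ 2) (int k) \<noteq> 0"
  shows "((\<lambda>t. lhs_term n l (as t) (qs t) k) \<longlongrightarrow> lhs_term n l a q k) F"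
  unfolding lhs_term_def using assms
  by (intro tendsto_intros qpoch_tendsto qpoch_defined_of_nat) auto

text \<open>If 3 does not divide \<open>n - i\<close>, the factor \<open>chi\<close> makes the
  summand identically zero; the nonvanishing conditions concern the other indices.\<close>

lemma rhs_term_tendsto:
  assumes "(as \<longlongrightarrow> a) F" "(qs \<longlongrightarrow> q) F" "q \<noteq> 0" "a \<noteq> 0"
    and ne: "3 dvd (int n - int i) \<Longrightarrow>
           a - q powi (- 2 * int n) \<noteq> 0
         \<and> qpoch q q (int i) \<noteq> 0
         \<and> qpoch (q powi (1 + int l - 2 * int n) / a) q (int i) \<noteq> 0
         \<and> qpoch (q powi (int n - int i) * a) q (int i) \<noteq> 0
         \<and> qpoch_defined q (q ^ 3) ((int n - int i) div 3)
         \<and> qpoch_defined (q ^ 2) (q ^ 3) ((int n - int i) div 3)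
         \<and> qpoch_defined (q * a) (q ^ 3) ((int n - int i) div 3)
         \<and> qpoch_defined (q ^ 2 * a) (q ^ 3) ((int n - int i) div 3)
         \<and> qpoch (q * a) (q ^ 3) ((int n - int i) div 3) \<noteq> 0
         \<and> qpoch (q ^ 2 * a) (q ^ 3) ((int n - int i) div 3) \<noteq> 0"
  shows "((\<lambda>t. rhs_term n l (as t) (qs t) i) \<longlongrightarrow> rhs_term n l a q i) F"
proof (cases "3 dvd (int n - int i)")
  case True
  show ?thesis unfolding rhs_term_def using assms(1-4) ne[OF True]
    by (intro tendsto_intros qpoch_tendsto qpoch_defined_of_nat) auto
next
  case False
  thus ?thesis by (simp add: rhs_term_def chi_def)
qed

text \<open>Identifies each right-hand summand as a connection coefficient times the value from
  \<open>cubic_sum\<close> at \<open>p = n - i\<close>. For \<open>i > n\<close> both sides vanish,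
  the left one through the zero factor at index \<open>n\<close> of the product starting at
  \<open>q\<close> to the power \<open>-n\<close>.\<close>

lemma generic_rhs_term:
  assumes "q \<noteq> 0" "a \<noteq> 0"
  shows "qpoch (q powi (int n - int l) * a) q (int l) / qpoch (q powi (2 * int n - int l) * a) q (int l)
           * rhs_term n l a q i
         = expansion_coeff q a (q ^ n) l i
           * (if i \<le> n \<and> 3 dvd (n - i)
              then a ^ ((n - i) div 3)
                * (qprod q (q ^ 3) ((n - i) div 3) * qprod (q ^ 2) (q ^ 3) ((n - i) div 3))
                / (qprod (q * a) (q ^ 3) ((n - i) div 3) * qprod (q ^ 2 * a) (q ^ 3) ((n - i) div 3))
              else 0)"
proof -
  consider "i > n" | "i \<le> n" "\<not> 3 dvd (n - i)" | "i \<le> n" "3 dvd (n - i)" by linarith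
  thus ?thesis
  proof cases
    case 1
    thus ?thesis using qprod_neg_power_eq_0[OF assms(1) 1]
      by (simp add: rhs_term_def qpoch_of_nat)
  next
    case 2
    have "int n - int i = int (n - i)" using 2 by simp
    hence "\<not> 3 dvd (int n - int i)" using 2(2) by presburger
    thus ?thesis using 2 by (simp add: rhs_term_def chi_def)
  next
    case 3
    then obtain m where "n - i = 3 * m" by blast
    \<comment> \<open>This makes both divisions by 3 exact: \<open>(n + 2 * i) / 3 = m + i\<close>
      and \<open>(n - i) / 3 = m\<close>.\<close>
    hence n: "n = 3 * m + i" using 3 by simp
    define u where "u = q ^ n"
    have u: "u \<noteq> 0" using assms by (simp add: u_def)
    have u2: "q powi (2 * int n) = u ^ 2"
      unfolding u_def by (metis mult.commute of_nat_mult of_nat_numeral power_int_of_nat power_mult)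
    have e1: "(int n + 2 * int i) div 3 = int (m + i)" "(int n - int i) div 3 = int m" "3 dvd (int n - int i)"
      by (simp_all add: n)
    have e2: "q powi (int n - int l) * a = u * a / q ^ l" "q powi (int n - int i) * a = u * a / q ^ i"
      using assms by (simp_all add: power_int_diff u_def)
    have e3: "q powi (2 * int n - int l) * a = u ^ 2 * a / q ^ l"
      using assms by (simp add: power_int_diff u2)
    have e4: "q powi (- int l) = 1 / q ^ l" "q powi (- int n) = 1 / u"
      using assms by (simp_all add: power_int_minus u_def field_simps)
    have e5: "q powi (- 2 * int n) / a = 1 / (u ^ 2 * a)"
      unfolding mult_minus_left power_int_minus u2 using assms u by (simp add: field_simps)
    have e6: "q powi (1 + int l - 2 * int n) / a = q ^ Suc l / (u ^ 2 * a)"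
      using assms u by (simp add: power_int_diff power_int_add u2)
    have e7: "q powi ((int l + 2 * int n - int i) * int i) = (u ^ 2) ^ i * q powi ((int l - int i) * int i)"
    proof -
      have "(int l + 2 * int n - int i) * int i = 2 * int n * int i + (int l - int i) * int i"
        by (simp add: algebra_simps)
      thus ?thesis using assms(1) 
        by (simp only: power_int_add power_int_mult[of q "2 * int n"] u2 power_int_of_nat simp_thms)
    qed
    have e8: "(a - q powi (2 * int i - 2 * int n)) / (a - q powi (- 2 * int n))
        = (1 - q ^ (2 * i) / (u ^ 2 * a)) / (1 - 1 / (u ^ 2 * a))"
    proof -
      have i2: "q powi (2 * int i) = q ^ (2 * i)"
        by (metis of_nat_mult of_nat_numeral power_int_of_nat)
      have "a - q powi (2 * int i - 2 * int n) = a * (1 - q ^ (2 * i) / (u ^ 2 * a))"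
        "a - q powi (- 2 * int n) = a * (1 - 1 / (u ^ 2 * a))"
        using assms u by (simp_all add: power_int_diff power_int_minus u2 i2 right_diff_distrib divide_inverse)
      thus ?thesis using assms by simp
    qed
    have e9: "a powi int (m + i) = a ^ m * a ^ i" by (simp only: power_int_of_nat power_add)
    have "(n - i) div 3 = m" by (simp add: n)
    thus ?thesis using 3
      unfolding rhs_term_def e1 e2 e3 e4 e5 e6 e7 e8 e9 qpoch_of_nat expansion_coeff_def u_def [symmetric]
      by (simp add: chi_def e1 power_mult_distrib mult_ac)
  qed
qed

text \<open>Expanding every pair by \<open>qprod_pair_expansion\<close> and exchanging the sums
  leaves inner sums over \<open>k\<close> that \<open>cubic_sum\<close> evaluates.\<close>

lemma generic_identity:
  assumes "q \<noteq> 0" "a \<noteq> 0"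
    and q: "\<And>k. q ^ Suc k \<noteq> 1" and a: "\<And>j. a * q powi j \<noteq> 1"
  shows "(\<Sum>k=0..n. lhs_term n l a q k)
         = qpoch (q powi (int n - int l) * a) q (int l) / qpoch (q powi (2 * int n - int l) * a) q (int l)
           * (\<Sum>i=0..l. rhs_term n l a q i)"
proof -
  define w where "w k = qprod a (q ^ 3) k * q ^ k / (qprod q q k * qprod a q (2 * k))" for k
  define u where "u = q ^ n"
  define P where "P i k = qprod (q ^ i / u) q k * qprod (u * a / q ^ i) q k" for i k
  have u: "u \<noteq> 0" using assms by (simp add: u_def)
  have ua: "u * a * q powi j \<noteq> 1" for j
    using a[of "int n + j"] assms(1) by (simp add: u_def power_int_add mult_ac)
  have uua: "u ^ 2 * a * q powi j \<noteq> 1" for j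
    using a[of "int (n + n) + j"] assms(1)
    by (simp add: u_def power_int_add power2_eq_square power_add mult_ac del: of_nat_add)
  have "lhs_term n l a q k = w k * (qprod (1 / u) q k * qprod (u * a / q ^ l) q k)" for k
    unfolding lhs_term_def w_def qpoch_of_nat qprod_even_odd [symmetric] using assms(1)
    by (simp add: u_def power_int_diff power_int_minus divide_inverse mult_ac)
  also have "\<dots> k = (\<Sum>i\<le>l. expansion_coeff q a u l i * (w k * P i k))" for k
    unfolding qprod_pair_expansion[OF assms(1,2) u q ua uua] P_def
    by (simp add: sum_distrib_left mult_ac)
  finally have "(\<Sum>k=0..n. lhs_term n l a q k) = (\<Sum>i\<le>l. expansion_coeff q a u l i * (\<Sum>k\<le>n. w k * P i k))"
    by (simp add: atLeast0AtMost sum_distrib_left) (rule sum.swap)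
  also have "\<dots> = (\<Sum>i\<le>l. qpoch (q powi (int n - int l) * a) q (int l)
         / qpoch (q powi (2 * int n - int l) * a) q (int l) * rhs_term n l a q i)"
  proof (rule sum.cong [OF refl])
    fix i
    show "expansion_coeff q a u l i * (\<Sum>k\<le>n. w k * P i k) = qpoch (q powi (int n - int l) * a) q (int l)
         / qpoch (q powi (2 * int n - int l) * a) q (int l) * rhs_term n l a q i"
    proof (cases "i \<le> n")
      case True
      \<comment> \<open>Cancelling \<open>q ^ i\<close> against \<open>u = q ^ n\<close> turns
        \<open>P i k\<close> into the pair of products for \<open>p = n - i\<close>.\<close>
      have un: "q ^ n = q ^ i * q ^ (n - i)" using True by (simp flip: power_add)
      have "P i k = qprod (q powi (- int (n - i))) q k * qprod (q powi (int (n - i)) * a) q k" for k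
        unfolding P_def u_def un power_int_minus power_int_of_nat using assms(1)
        by (simp add: inverse_eq_divide)
      thus ?thesis
        unfolding generic_rhs_term[OF assms(1,2)] u_def w_def
        using cubic_sum[OF assms, of "n - i" n] True by simp
    next
      case False
      \<comment> \<open>For \<open>i > n\<close> there is no sum to evaluate; the coefficient itself
        is zero.\<close>
      have "qprod (1 / u) q i = 0"
        using qprod_neg_power_eq_0[OF assms(1), of n i] False by (simp add: u_def power_int_minus divide_inverse)
      thus ?thesis
        unfolding generic_rhs_term[OF assms(1,2)] using False by (simp add: expansion_coeff_def)
    qed
  qed
  finally show ?thesis by (simp add: atLeast0AtMost sum_distrib_left)
qed

section \<open>The identity for all admissible parameters, by passage to the limit\<close>

theorem theorem1:
  fixes l n :: nat and a q sqrt_a sqrt_qa :: complex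
  assumes "a \<noteq> 0" and "q \<noteq> 0"
    and "sqrt_a ^ 2 = a" and "sqrt_qa ^ 2 = q * a"
    and lhs_denominators:
      "\<forall>k\<in>{0..n}. qpoch q q (int k) \<noteq> 0
         \<and> qpoch sqrt_a q (int k) \<noteq> 0 \<and> qpoch (- sqrt_a) q (int k) \<noteq> 0
         \<and> qpoch sqrt_qa q (int k) \<noteq> 0 \<and> qpoch (- sqrt_qa) q (int k) \<noteq> 0"
    and rhs_prefactor_denominator:
      "qpoch (q powi (2 * int n - int l) * a) q (int l) \<noteq> 0"
    and rhs_denominators:
      "\<forall>i\<in>{0..l}. 3 dvd (int n - int i) \<longrightarrow>
           a - q powi (- 2 * int n) \<noteq> 0
         \<and> qpoch q q (int i) \<noteq> 0
         \<and> qpoch (q powi (1 + int l - 2 * int n) / a) q (int i) \<noteq> 0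
         \<and> qpoch (q powi (int n - int i) * a) q (int i) \<noteq> 0
         \<and> qpoch_defined q (q ^ 3) ((int n - int i) div 3)
         \<and> qpoch_defined (q ^ 2) (q ^ 3) ((int n - int i) div 3)
         \<and> qpoch_defined (q * a) (q ^ 3) ((int n - int i) div 3)
         \<and> qpoch_defined (q ^ 2 * a) (q ^ 3) ((int n - int i) div 3)
         \<and> qpoch (q * a) (q ^ 3) ((int n - int i) div 3) \<noteq> 0
         \<and> qpoch (q ^ 2 * a) (q ^ 3) ((int n - int i) div 3) \<noteq> 0"
  shows
    "(\<Sum>k=0..n.
        qpoch a (q ^ 3) (int k)
        * ((qpoch (q powi (- int n)) q (int k) * qpoch (q powi (int n - int l) * a) q (int k))
           / (qpoch q q (int k) * qpoch sqrt_a q (int k) * qpoch (- sqrt_a) q (int k)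
              * qpoch sqrt_qa q (int k) * qpoch (- sqrt_qa) q (int k)))
        * q ^ k)
     = qpoch (q powi (int n - int l) * a) q (int l)
         / qpoch (q powi (2 * int n - int l) * a) q (int l)
       * (\<Sum>i=0..l.
           a powi ((int n + 2 * int i) div 3)
           * q powi ((int l + 2 * int n - int i) * int i)
           * ((a - q powi (2 * int i - 2 * int n)) / (a - q powi (- 2 * int n)))
           * ((qpoch (q powi (- int l)) q (int i) * qpoch (q powi (- int n)) q (int i)
               * qpoch (q powi (- 2 * int n) / a) q (int i))
              / (qpoch q q (int i) * qpoch (q powi (1 + int l - 2 * int n) / a) q (int i)
                 * qpoch (q powi (int n - int i) * a) q (int i)))
           * ((qpoch q (q ^ 3) ((int n - int i) div 3)
               * qpoch (q ^ 2) (q ^ 3) ((int n - int i) div 3))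
              / (qpoch (q * a) (q ^ 3) ((int n - int i) div 3)
                 * qpoch (q ^ 2 * a) (q ^ 3) ((int n - int i) div 3)))
           * chi (int n - int i))"
proof -
  have square: "qpoch s q (int k) * qpoch (- s) q (int k) = qpoch x (q ^ 2) (int k)" if "s ^ 2 = x" for s x k
    unfolding qpoch_of_nat using that by (rule qprod_pair_square)
  note square_a = square[OF assms(3)] and square_qa = square[OF assms(4)]
  obtain as qs where gen: "as \<longlonglongrightarrow> a" "qs \<longlonglongrightarrow> q" "\<And>t. as t \<noteq> 0" "\<And>t. qs t \<noteq> 0"
    "\<And>t k. qs t ^ Suc k \<noteq> 1" "\<And>t j. as t * qs t powi j \<noteq> 1"
    using generic_sequences[of a q] by blast
  \<comment> \<open>Nonvanishing of the square-root products gives, in pairs, nonvanishing of the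
    denominators in base \<open>q ^ 2\<close>.\<close>
  have lhs: "(\<lambda>t. \<Sum>k=0..n. lhs_term n l (as t) (qs t) k) \<longlonglongrightarrow> (\<Sum>k=0..n. lhs_term n l a q k)"
    using lhs_denominators
    by (intro tendsto_sum lhs_term_tendsto gen \<open>q \<noteq> 0\<close>)
       (auto simp: square_a [symmetric] square_qa [symmetric])
  have rhs: "(\<lambda>t. qpoch (qs t powi (int n - int l) * as t) (qs t) (int l)
          / qpoch (qs t powi (2 * int n - int l) * as t) (qs t) (int l) * (\<Sum>i=0..l. rhs_term n l (as t) (qs t) i))
      \<longlonglongrightarrow> qpoch (q powi (int n - int l) * a) q (int l)
          / qpoch (q powi (2 * int n - int l) * a) q (int l) * (\<Sum>i=0..l. rhs_term n l a q i)"
    using rhs_denominators \<open>q \<noteq> 0\<close>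
    by (intro tendsto_mult tendsto_divide tendsto_sum qpoch_tendsto qpoch_defined_of_nat tendsto_power_int
        rhs_term_tendsto gen rhs_prefactor_denominator \<open>a \<noteq> 0\<close>) auto
  have "(\<Sum>k=0..n. lhs_term n l a q k) = qpoch (q powi (int n - int l) * a) q (int l)
          / qpoch (q powi (2 * int n - int l) * a) q (int l) * (\<Sum>i=0..l. rhs_term n l a q i)"
    using LIMSEQ_unique[OF lhs] rhs generic_identity[OF gen(4,3,5,6)] by simp
  moreover have "lhs_term n l a q k = qpoch a (q ^ 3) (int k)
        * ((qpoch (q powi (- int n)) q (int k) * qpoch (q powi (int n - int l) * a) q (int k))
           / (qpoch q q (int k) * qpoch sqrt_a q (int k) * qpoch (- sqrt_a) q (int k)
              * qpoch sqrt_qa q (int k) * qpoch (- sqrt_qa) q (int k)))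
        * q ^ k" for k
    unfolding lhs_term_def square_a [symmetric] square_qa [symmetric] by (simp only: mult.assoc)
  ultimately show ?thesis
    unfolding rhs_term_def by simp
qed

end
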